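(* Let $p\le n$ be positive integers, let $G\in\mathbb{H}^{n\times n}$ be Hermitian positive definite, and let $\mathbb{H}^{n\times p}\ni X\mapsto M_X\in\mathrm{Her}(n)$ be a smooth map such that $M_X$ is positive definite for every $X$. Equip $\mathbb{H}^{n\times p}$ with the Riemannian metric $\langle\xi,\eta\rangle_X=\mathrm{Re}(\mathrm{tr}(\xi^HM_X\eta))$ for $\xi,\eta\in\mathbb{H}^{n\times p}$, $X\in\mathbb{H}^{n\times p}$. For $X\in\mathrm{St}_G(p,\mathbb{H}^n)=\{X\in\mathbb{H}^{n\times p}\mid X^HGX=I_p\}$, the normal space of $\mathrm{St}_G(p,\mathbb{H}^n)$ at $X$, i.e. the orthogonal complement of $T_X\mathrm{St}_G(p,\mathbb{H}^n)$ in $T_X\mathbb{H}^{n\times p}=\mathbb{H}^{n\times p}$ with respect to $\langle\cdot,\cdot\rangle_X$, is $$N_X\mathrm{St}_G(p,\mathbb{H}^n)=\{M_X^{-1}GXS\mid S\in\mathrm{Her}(p)\}.$$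
   Context: $\mathbb{H}$ denotes the quaternions $q=q_0+q_1i+q_2j+q_3k$ with conjugate $\bar q=q_0-q_1i-q_2j-q_3k$ and real part $\mathrm{Re}(q)=q_0$; for a quaternionic matrix $A$, $A^H=\bar A^{\top}$ is the conjugate transpose. $\mathrm{Her}(n)=\{A\in\mathbb{H}^{n\times n}\mid A^H=A\}$; $A\in\mathrm{Her}(n)$ is positive definite if $x^HAx>0$ for every nonzero $x\in\mathbb{H}^n$. $\mathbb{H}^{n\times p}$ is regarded as a real vector space of dimension $4np$ via $A_0+A_1i+A_2j+A_3k\mapsto(A_0,A_1,A_2,A_3)\in(\mathbb{R}^{n\times p})^4$, and $\mathrm{St}_G(p,\mathbb{H}^n)$ is regarded as a real embedded submanifold of it, whose tangent space at $X$ is $T_X\mathrm{St}_G(p,\mathbb{H}^n)=\{\xi\in\mathbb{H}^{n\times p}\mid\xi^HGX+X^HG\xi=0\}$. *)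

theory Defs
  imports "HOL-Analysis.Analysis"
begin

section \<open>Quaternions\<close>

datatype quat = Quat (qre: real) (qim1: real) (qim2: real) (qim3: real)

lemma quat_eq_iff:
  "x = y \<longleftrightarrow> qre x = qre y \<and> qim1 x = qim1 y \<and> qim2 x = qim2 y \<and> qim3 x = qim3 y"
  by (cases x; cases y) simp

instantiation quat :: "{zero, one, plus, minus, uminus, times, scaleR}"
begin

definition "0 = Quat 0 0 0 0"
definition "1 = Quat 1 0 0 0"
definition "x + y = Quat (qre x + qre y) (qim1 x + qim1 y) (qim2 x + qim2 y) (qim3 x + qim3 y)"
definition "x - y = Quat (qre x - qre y) (qim1 x - qim1 y) (qim2 x - qim2 y) (qim3 x - qim3 y)"
definition "- x = Quat (- qre x) (- qim1 x) (- qim2 x) (- qim3 x)"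
definition "x * y = Quat
  (qre x * qre y - qim1 x * qim1 y - qim2 x * qim2 y - qim3 x * qim3 y)
  (qre x * qim1 y + qim1 x * qre y + qim2 x * qim3 y - qim3 x * qim2 y)
  (qre x * qim2 y - qim1 x * qim3 y + qim2 x * qre y + qim3 x * qim1 y)
  (qre x * qim3 y + qim1 x * qim2 y - qim2 x * qim1 y + qim3 x * qre y)"
definition "r *\<^sub>R x = Quat (r * qre x) (r * qim1 x) (r * qim2 x) (r * qim3 x)"

instance ..

end

lemma quat_sel [simp]:
  "qre 0 = 0" "qim1 0 = 0" "qim2 0 = 0" "qim3 0 = 0"
  "qre 1 = 1" "qim1 1 = 0" "qim2 1 = 0" "qim3 1 = 0"
  "qre (x + y) = qre x + qre y" "qim1 (x + y) = qim1 x + qim1 y"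
  "qim2 (x + y) = qim2 x + qim2 y" "qim3 (x + y) = qim3 x + qim3 y"
  "qre (x - y) = qre x - qre y" "qim1 (x - y) = qim1 x - qim1 y"
  "qim2 (x - y) = qim2 x - qim2 y" "qim3 (x - y) = qim3 x - qim3 y"
  "qre (- x) = - qre x" "qim1 (- x) = - qim1 x" "qim2 (- x) = - qim2 x" "qim3 (- x) = - qim3 x"
  "qre (r *\<^sub>R x) = r * qre x" "qim1 (r *\<^sub>R x) = r * qim1 x"
  "qim2 (r *\<^sub>R x) = r * qim2 x" "qim3 (r *\<^sub>R x) = r * qim3 x"
  by (simp_all add: zero_quat_def one_quat_def plus_quat_def minus_quat_def uminus_quat_def
      scaleR_quat_def)

lemma quat_sel_mult:
  "qre (x * y) = qre x * qre y - qim1 x * qim1 y - qim2 x * qim2 y - qim3 x * qim3 y"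
  "qim1 (x * y) = qre x * qim1 y + qim1 x * qre y + qim2 x * qim3 y - qim3 x * qim2 y"
  "qim2 (x * y) = qre x * qim2 y - qim1 x * qim3 y + qim2 x * qre y + qim3 x * qim1 y"
  "qim3 (x * y) = qre x * qim3 y + qim1 x * qim2 y - qim2 x * qim1 y + qim3 x * qre y"
  by (simp_all add: times_quat_def)

instance quat :: real_algebra_1
  by standard (simp_all add: quat_eq_iff quat_sel_mult algebra_simps)

instantiation quat :: real_inner
begin

definition inner_quat_def:
  "inner x y = qre x * qre y + qim1 x * qim1 y + qim2 x * qim2 y + qim3 x * qim3 y"
definition "norm (x::quat) = sqrt (inner x x)"
definition "sgn (x::quat) = x /\<^sub>R norm x"
definition "dist (x::quat) y = norm (x - y)"
definition
  "(uniformity :: (quat \<times> quat) filter) = (INF e\<in>{0 <..}. principal {(x, y). dist x y < e})"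
definition
  "open (U :: quat set) \<longleftrightarrow> (\<forall>x\<in>U. eventually (\<lambda>(x', y). x' = x \<longrightarrow> y \<in> U) uniformity)"

instance
proof
  fix x y z :: quat and r :: real
  show "inner x y = inner y x"
    by (simp add: inner_quat_def mult.commute)
  show "inner (x + y) z = inner x z + inner y z"
    by (simp add: inner_quat_def distrib_right)
  show "inner (r *\<^sub>R x) y = r * inner x y"
    by (simp add: inner_quat_def distrib_left mult.assoc)
  show "0 \<le> inner x x"
    by (simp add: inner_quat_def)
  show "inner x x = 0 \<longleftrightarrow> x = 0"
    by (auto simp: inner_quat_def quat_eq_iff add_nonneg_eq_0_iff)
qed (rule norm_quat_def sgn_quat_def dist_quat_def open_quat_def uniformity_quat_def)+

end

instantiation quat :: euclidean_space
begin

definition "Basis = {Quat 1 0 0 0, Quat 0 1 0 0, Quat 0 0 1 0, Quat 0 0 0 1}"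

instance
proof
  fix u v x :: quat
  show "(Basis :: quat set) \<noteq> {}" "finite (Basis :: quat set)"
    by (simp_all add: Basis_quat_def)
  show "inner u v = (if u = v then 1 else 0)" if "u \<in> Basis" "v \<in> Basis"
    using that unfolding Basis_quat_def by (elim insertE emptyE) (simp_all add: inner_quat_def)
  show "(\<forall>u\<in>Basis. inner x u = 0) \<longleftrightarrow> x = 0"
    by (cases x) (simp add: Basis_quat_def inner_quat_def zero_quat_def)
qed

end

definition qcnj :: "quat \<Rightarrow> quat" where
  "qcnj q = Quat (qre q) (- qim1 q) (- qim2 q) (- qim3 q)"

section \<open>Quaternionic matrices\<close>

definition ctranspose :: "quat^'m^'n \<Rightarrow> quat^'n^'m" where
  "ctranspose A = (\<chi> i j. qcnj (A $ j $ i))"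

definition Her :: "(quat^'n^'n) set" where
  "Her = {A. ctranspose A = A}"

text \<open>The condition \<open>x\<^sup>H A x > 0\<close> says that this quaternion is a positive real number.\<close>

definition pos_def :: "quat^'n^'n \<Rightarrow> bool" where
  "pos_def A \<longleftrightarrow> A \<in> Her \<and>
     (\<forall>x. x \<noteq> 0 \<longrightarrow> (\<exists>r>0. (\<Sum>i\<in>UNIV. qcnj (x $ i) * (A *v x) $ i) = of_real r))"

section \<open>Smooth maps between Euclidean spaces\<close>

text \<open>\<open>k\<close> times continuously differentiable: the derivative exists everywhere, and each directional
  derivative, as a function of the point, is \<open>k - 1\<close> times continuously differentiable.\<close>

primrec Ck :: "nat \<Rightarrow> ('a::euclidean_space \<Rightarrow> 'b::euclidean_space) \<Rightarrow> bool" where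
  "Ck 0 f \<longleftrightarrow> continuous_on UNIV f"
| "Ck (Suc k) f \<longleftrightarrow>
     (\<exists>f'. (\<forall>x. (f has_derivative f' x) (at x)) \<and> (\<forall>v. Ck k (\<lambda>x. f' x v)))"

definition smooth :: "('a::euclidean_space \<Rightarrow> 'b::euclidean_space) \<Rightarrow> bool" where
  "smooth f \<longleftrightarrow> (\<forall>k. Ck k f)"

section \<open>The generalized Stiefel manifold\<close>

definition stiefel :: "quat^'n^'n \<Rightarrow> (quat^'p^'n) set" where
  "stiefel G = {X. ctranspose X ** G ** X = mat 1}"

text \<open>The kernel of the derivative at \<open>X\<close> of the defining map \<open>X \<mapsto> X\<^sup>H G X\<close>.\<close>

definition stiefel_tangent_space :: "quat^'n^'n \<Rightarrow> quat^'p^'n \<Rightarrow> (quat^'p^'n) set" where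
  "stiefel_tangent_space G X = {\<xi>. ctranspose \<xi> ** G ** X + ctranspose X ** G ** \<xi> = 0}"

definition riem_metric ::
  "(quat^'p^'n \<Rightarrow> quat^'n^'n) \<Rightarrow> quat^'p^'n \<Rightarrow> quat^'p^'n \<Rightarrow> quat^'p^'n \<Rightarrow> real" where
  "riem_metric M X \<xi> \<eta> = qre (trace (ctranspose \<xi> ** M X ** \<eta>))"

text \<open>The orthogonal complement of the tangent space for \<open>riem_metric M X\<close>, not for the standard
  inner product.\<close>

definition stiefel_normal_space ::
  "(quat^'p^'n \<Rightarrow> quat^'n^'n) \<Rightarrow> quat^'n^'n \<Rightarrow> quat^'p^'n \<Rightarrow> (quat^'p^'n) set" where
  "stiefel_normal_space M G X = {\<nu>. \<forall>\<xi>\<in>stiefel_tangent_space G X. riem_metric M X \<nu> \<xi> = 0}"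

end

theory Submission
  imports Defs
begin

text \<open>The metric at \<open>X\<close> is \<open>\<langle>\<nu>, \<xi>\<rangle> = Re tr (\<nu>\<^sup>H M\<^sub>X \<xi>)\<close>. Quaternions do not commute, but the real part of a
  product does not see the order of its factors, so \<open>Re tr\<close> is still cyclic and invariant under
  conjugate transposition, and \<open>Re tr (Z\<^sup>H Z)\<close> is the sum of the squared norms of the entries
  of \<open>Z\<close>. Everything below rests on these facts (\<open>qre_trace_mult_commute\<close>, \<open>qre_trace_ctranspose\<close>,
  \<open>ctranspose_mult_self_trace_eq_0\<close>).

  A vector of the form \<open>M\<^sub>X\<^sup>-\<^sup>1 G X S\<close> with \<open>S\<close> Hermitian is normal: its product with a tangent
  vector \<open>\<xi>\<close> is \<open>Re tr (S (X\<^sup>H G \<xi>))\<close>, and tangency says precisely that \<open>X\<^sup>H G \<xi>\<close> is skew-Hermitian,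
  hence orthogonal to \<open>S\<close>.

  For the converse, multiplying \<open>M\<^sub>X \<nu> = G X S\<close> by \<open>X\<^sup>H\<close> and using \<open>X\<^sup>H G X = I\<close> shows that the only
  candidate is \<open>S = X\<^sup>H M\<^sub>X \<nu>\<close>. Two families of tangent vectors suffice to confirm it. The vectors
  \<open>X \<Omega>\<close> with \<open>\<Omega>\<close> skew-Hermitian force \<open>S\<close> to have no skew-Hermitian part, so \<open>S\<close> is Hermitian. The
  vectors \<open>\<eta> - X X\<^sup>H G \<eta>\<close>, with \<open>\<eta>\<close> arbitrary, force \<open>M\<^sub>X \<nu> - G X S = 0\<close>. No count of dimensions
  is involved.\<close>

section \<open>Quaternionic conjugation and conjugate transposes\<close>

lemma qcnj_sel [simp]:
  "qre (qcnj q) = qre q" "qim1 (qcnj q) = - qim1 q"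
  "qim2 (qcnj q) = - qim2 q" "qim3 (qcnj q) = - qim3 q"
  by (simp_all add: qcnj_def)

lemma qcnj_qcnj [simp]: "qcnj (qcnj q) = q"
  by (simp add: quat_eq_iff)

lemma qcnj_0 [simp]: "qcnj 0 = 0" and qcnj_1 [simp]: "qcnj 1 = 1"
  by (simp_all add: quat_eq_iff)

lemma qcnj_add: "qcnj (x + y) = qcnj x + qcnj y"
  by (simp add: quat_eq_iff)

lemma qcnj_diff: "qcnj (x - y) = qcnj x - qcnj y"
  by (simp add: quat_eq_iff)

lemma qcnj_mult: "qcnj (x * y) = qcnj y * qcnj x"
  by (simp add: quat_eq_iff quat_sel_mult)

lemma qcnj_sum: "qcnj (sum f A) = (\<Sum>x\<in>A. qcnj (f x))"
  by (induction A rule: infinite_finite_induct) (simp_all add: qcnj_add)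

lemma qre_sum: "qre (sum f A) = (\<Sum>x\<in>A. qre (f x))"
  by (induction A rule: infinite_finite_induct) simp_all

lemma qre_mult_commute: "qre (x * y) = qre (y * x)"
  by (simp add: quat_sel_mult)

lemma qre_qcnj_mult_self: "qre (qcnj q * q) = (norm q)\<^sup>2"
  by (simp add: power2_norm_eq_inner inner_quat_def quat_sel_mult)

lemma ctranspose_ctranspose [simp]: "ctranspose (ctranspose A) = A"
  by (simp add: ctranspose_def vec_eq_iff)

lemma ctranspose_mat_1 [simp]: "ctranspose (mat 1) = mat 1"
  by (simp add: ctranspose_def vec_eq_iff mat_def)

lemma ctranspose_diff: "ctranspose (A - B) = ctranspose A - ctranspose B"
  by (simp add: ctranspose_def vec_eq_iff qcnj_diff)

lemma ctranspose_mult: "ctranspose (A ** B) = ctranspose B ** ctranspose A"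
  by (simp add: ctranspose_def vec_eq_iff matrix_matrix_mult_def qcnj_sum qcnj_mult)

lemma matrix_mult_diff_right: "A ** (B - C) = A ** B - A ** C"
  for A :: "'a::ring_1^'m^'n"
  by (simp add: vec_eq_iff matrix_matrix_mult_def right_diff_distrib sum_subtractf)

lemma matrix_mult_diff_left: "(A - B) ** C = A ** C - B ** C"
  for A :: "'a::ring_1^'m^'n"
  by (simp add: vec_eq_iff matrix_matrix_mult_def left_diff_distrib sum_subtractf)

lemma matrix_mult_minus_left: "(- A) ** B = - (A ** B)"
  for A :: "'a::ring_1^'m^'n"
  by (simp add: vec_eq_iff matrix_matrix_mult_def sum_negf)

section \<open>The real part of the trace\<close>

lemma qre_trace_diff: "qre (trace (A - B)) = qre (trace A) - qre (trace B)"
  by (simp add: trace_def qre_sum sum_subtractf)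

lemma qre_trace_uminus: "qre (trace (- A)) = - qre (trace A)"
  by (simp add: trace_def qre_sum sum_negf)

lemma qre_trace_ctranspose: "qre (trace (ctranspose A)) = qre (trace A)"
  by (simp add: trace_def ctranspose_def qre_sum)

lemma qre_trace_mult_commute:
  fixes A :: "quat^'m^'n" and B :: "quat^'n^'m"
  shows "qre (trace (A ** B)) = qre (trace (B ** A))"
proof -
  have "qre (trace (A ** B)) = (\<Sum>i\<in>UNIV. \<Sum>k\<in>UNIV. qre (A $ i $ k * B $ k $ i))"
    by (simp add: trace_def matrix_matrix_mult_def qre_sum)
  also have "\<dots> = (\<Sum>k\<in>UNIV. \<Sum>i\<in>UNIV. qre (B $ k $ i * A $ i $ k))"
    by (subst sum.swap) (simp only: qre_mult_commute)
  also have "\<dots> = qre (trace (B ** A))"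
    by (simp add: trace_def matrix_matrix_mult_def qre_sum)
  finally show ?thesis .
qed

lemma ctranspose_mult_self_trace_eq_0:
  fixes Z :: "quat^'m^'n"
  assumes "qre (trace (ctranspose Z ** Z)) = 0"
  shows "Z = 0"
proof -
  have "qre (trace (ctranspose Z ** Z)) = (\<Sum>j\<in>UNIV. \<Sum>i\<in>UNIV. (norm (Z $ i $ j))\<^sup>2)"
    by (simp add: trace_def matrix_matrix_mult_def ctranspose_def qre_sum qre_qcnj_mult_self)
  with assms have "\<forall>j i. Z $ i $ j = 0"
    by (simp add: sum_nonneg_eq_0_iff sum_nonneg)
  then show ?thesis
    by (simp add: vec_eq_iff)
qed

text \<open>Conjugate transposition keeps \<open>Re tr (S W)\<close>, but reverses the factors and flips the sign of
  \<open>W\<close>; by cyclicity the number then equals its own negative.\<close>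

lemma qre_trace_Her_skew:
  assumes "S \<in> Her" and skew: "ctranspose W = - W"
  shows "qre (trace (S ** W)) = 0"
proof -
  have "qre (trace (S ** W)) = qre (trace (ctranspose W ** ctranspose S))"
    by (metis ctranspose_mult qre_trace_ctranspose)
  also have "\<dots> = qre (trace (- (W ** S)))"
    using assms by (simp add: Her_def matrix_mult_minus_left)
  also have "\<dots> = - qre (trace (S ** W))"
    by (simp add: qre_trace_uminus qre_trace_mult_commute[of W])
  finally show ?thesis
    by simp
qed

text \<open>It is enough to test against \<open>W = S - S\<^sup>H\<close>, twice the skew-Hermitian part of \<open>S\<close>: both \<open>S\<close>
  and \<open>S\<^sup>H\<close> are then orthogonal to \<open>W\<close>, hence so is \<open>W\<close> itself.\<close>

lemma Her_if_orthogonal_to_skew: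
  fixes S :: "quat^'n^'n"
  assumes "\<And>W. ctranspose W = - W \<Longrightarrow> qre (trace (ctranspose S ** W)) = 0"
  shows "S \<in> Her"
proof -
  define W where "W = S - ctranspose S"
  have skew: "ctranspose W = - W"
    by (simp add: W_def ctranspose_diff)
  have orth: "qre (trace (ctranspose S ** W)) = 0"
    using assms skew by blast
  have "qre (trace (S ** W)) = qre (trace (ctranspose W ** ctranspose S))"
    by (metis ctranspose_mult qre_trace_ctranspose)
  also have "\<dots> = - qre (trace (ctranspose S ** W))"
    by (simp add: skew matrix_mult_minus_left qre_trace_uminus qre_trace_mult_commute[of W])
  also have "\<dots> = 0"
    using orth by simp
  finally have "qre (trace (S ** W)) = 0" .
  moreover have "ctranspose W ** W = ctranspose S ** W - S ** W"
    by (simp add: W_def ctranspose_diff matrix_mult_diff_left)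
  ultimately have "qre (trace (ctranspose W ** W)) = 0"
    using orth by (simp add: qre_trace_diff)
  then have "W = 0"
    by (rule ctranspose_mult_self_trace_eq_0)
  then show ?thesis
    by (simp add: W_def Her_def)
qed

section \<open>Positive definite matrices are invertible\<close>

lemma pos_def_mult_eq_0:
  assumes "pos_def A" and "A *v x = 0"
  shows "x = 0"
proof (rule ccontr)
  assume "x \<noteq> 0"
  with assms(1) obtain r where "r > 0" "(\<Sum>i\<in>UNIV. qcnj (x $ i) * (A *v x) $ i) = of_real r"
    unfolding pos_def_def by blast
  with assms(2) show False
    by simp
qed

text \<open>The quaternions do not commute, so determinants cannot decide this. Instead, \<open>x \<mapsto> A x\<close> is real-linear and
  injective on a finite-dimensional real space, hence onto, and the preimages of the standard unit
  vectors are the columns of a right inverse; injectivity makes it two-sided.\<close>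

lemma pos_def_invertible:
  fixes A :: "quat^'n^'n"
  assumes "pos_def A"
  shows "invertible A"
proof -
  have lin: "linear ((*v) A)"
    by (rule Finite_Cartesian_Product.matrix_vector_mul_linear)
  have "inj ((*v) A)"
    using pos_def_mult_eq_0[OF assms] by (simp add: linear_injective_0[OF lin])
  then have "surj ((*v) A)"
    by (rule linear_injective_imp_surjective[OF lin]) simp
  then have "\<forall>j. \<exists>x. A *v x = axis j 1"
    by (metis surjD)
  then obtain c where c: "\<And>j. A *v c j = axis j 1"
    by metis
  define B where "B = (\<chi> i j. c j $ i)"
  have AB: "A ** B = mat 1"
  proof -
    have "(A ** B) $ i $ j = (A *v c j) $ i" for i j
      by (simp add: B_def matrix_matrix_mult_def matrix_vector_mult_def)
    then show ?thesis
      by (simp add: c vec_eq_iff mat_def axis_def)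
  qed
  have "A ** (B ** A - mat 1) = 0"
    by (simp add: matrix_mult_diff_right matrix_mul_assoc AB)
  then have col: "A *v (\<chi> i. (B ** A - mat 1) $ i $ j) = 0" for j
    by (simp add: vec_eq_iff matrix_matrix_mult_def matrix_vector_mult_def)
  have "B ** A - mat 1 = 0"
    using pos_def_mult_eq_0[OF assms col] by (simp add: vec_eq_iff)
  with AB show ?thesis
    by (auto simp: invertible_def)
qed

lemma matrix_inv_mult:
  assumes "invertible A"
  shows "A ** matrix_inv A = mat 1" "matrix_inv A ** A = mat 1"
  using someI_ex[OF assms[unfolded invertible_def]] by (simp_all add: matrix_inv_def)

section \<open>Tangent and normal vectors of the Stiefel manifold\<close>

lemma stiefel_tangent_space_iff_skew:
  assumes "G \<in> Her"
  shows "\<xi> \<in> stiefel_tangent_space G X \<longleftrightarrow>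
    ctranspose (ctranspose X ** G ** \<xi>) = - (ctranspose X ** G ** \<xi>)"
  using assms
  by (simp add: stiefel_tangent_space_def Her_def ctranspose_mult matrix_mul_assoc eq_neg_iff_add_eq_0)

text \<open>The vectors \<open>\<eta> - X X\<^sup>H G \<eta>\<close> are the \<open>G\<close>-orthogonal projections of \<open>\<eta>\<close> away from the columns
  of \<open>X\<close>. They satisfy \<open>X\<^sup>H G \<xi> = 0\<close>, which is trivially skew-Hermitian.\<close>

lemma proj_in_stiefel_tangent_space:
  assumes "G \<in> Her" and "X \<in> stiefel G"
  shows "\<eta> - X ** (ctranspose X ** G ** \<eta>) \<in> stiefel_tangent_space G X"
proof -
  have "ctranspose X ** G ** (\<eta> - X ** (ctranspose X ** G ** \<eta>)) = 0"
    using assms(2) by (simp add: stiefel_def matrix_mult_diff_right matrix_mul_assoc)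
  then show ?thesis
    using assms(1) by (simp add: stiefel_tangent_space_iff_skew ctranspose_def vec_eq_iff)
qed

lemma mult_skew_in_stiefel_tangent_space:
  assumes "G \<in> Her" and "X \<in> stiefel G" and "ctranspose W = - W"
  shows "X ** W \<in> stiefel_tangent_space G X"
  using assms by (simp add: stiefel_tangent_space_iff_skew stiefel_def matrix_mul_assoc)

text \<open>As \<open>M\<^sub>X\<close> is Hermitian, it cancels against the conjugate transpose of its inverse, and the metric
  disappears from the product: this is the purpose of the factor \<open>M\<^sub>X\<^sup>-\<^sup>1\<close> in the normal vectors.\<close>

lemma riem_metric_inv_mult:
  assumes "pos_def (M X)" and "G \<in> Her" and "S \<in> Her"
  shows "riem_metric M X (matrix_inv (M X) ** G ** X ** S) \<xi> =
    qre (trace (S ** (ctranspose X ** G ** \<xi>)))"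
proof -
  have "M X ** matrix_inv (M X) = mat 1"
    using assms(1) by (intro matrix_inv_mult pos_def_invertible)
  then have "ctranspose (matrix_inv (M X)) ** ctranspose (M X) = mat 1"
    by (metis ctranspose_mult ctranspose_mat_1)
  then have inv: "ctranspose (matrix_inv (M X)) ** M X = mat 1"
    using assms(1) by (simp add: pos_def_def Her_def)
  have "ctranspose (matrix_inv (M X) ** G ** X ** S) ** M X
      = S ** ctranspose X ** G ** (ctranspose (matrix_inv (M X)) ** M X)"
    using assms(2,3) by (simp add: ctranspose_mult Her_def matrix_mul_assoc)
  then show ?thesis
    by (simp add: riem_metric_def inv matrix_mul_assoc)
qed

lemma normal_imp_Her:
  assumes "G \<in> Her" and "M X \<in> Her" and "X \<in> stiefel G" and "\<nu> \<in> stiefel_normal_space M G X"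
  shows "ctranspose X ** M X ** \<nu> \<in> Her"
proof (rule Her_if_orthogonal_to_skew)
  fix W :: "quat^'b^'b"
  assume "ctranspose W = - W"
  then have "riem_metric M X \<nu> (X ** W) = 0"
    using assms mult_skew_in_stiefel_tangent_space by (auto simp: stiefel_normal_space_def)
  then show "qre (trace (ctranspose (ctranspose X ** M X ** \<nu>) ** W)) = 0"
    using assms(2) by (simp add: riem_metric_def ctranspose_mult Her_def matrix_mul_assoc)
qed

text \<open>With \<open>Z\<close> the difference of the two sides, the product of \<open>\<nu>\<close> with the tangent vector
  \<open>\<eta> - X X\<^sup>H G \<eta>\<close> is \<open>Re tr (Z\<^sup>H \<eta>)\<close>, so \<open>\<eta> = Z\<close> gives \<open>Z = 0\<close>.\<close>

lemma normal_imp_mult_eq: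
  assumes "G \<in> Her" and "M X \<in> Her" and "X \<in> stiefel G" and "\<nu> \<in> stiefel_normal_space M G X"
  shows "M X ** \<nu> = G ** X ** (ctranspose X ** M X ** \<nu>)"
proof -
  define Z where "Z = M X ** \<nu> - G ** X ** (ctranspose X ** M X ** \<nu>)"
  have "riem_metric M X \<nu> (Z - X ** (ctranspose X ** G ** Z)) = 0"
    using assms proj_in_stiefel_tangent_space by (auto simp: stiefel_normal_space_def)
  moreover have "ctranspose Z ** Z
      = ctranspose \<nu> ** M X ** (Z - X ** (ctranspose X ** G ** Z))"
  proof -
    have "ctranspose Z = ctranspose \<nu> ** M X - ctranspose \<nu> ** M X ** X ** ctranspose X ** G"
      using assms(1,2) by (simp add: Z_def Her_def ctranspose_diff ctranspose_mult matrix_mul_assoc)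
    then show ?thesis
      by (simp add: matrix_mult_diff_left matrix_mult_diff_right matrix_mul_assoc)
  qed
  ultimately have "Z = 0"
    by (intro ctranspose_mult_self_trace_eq_0) (simp add: riem_metric_def)
  then show ?thesis
    by (simp add: Z_def)
qed

theorem proposition3:
  fixes G :: "quat^'n^'n"
    and M :: "quat^'p^'n \<Rightarrow> quat^'n^'n"
    and X :: "quat^'p^'n"
  assumes "CARD('p) \<le> CARD('n)"
    and "pos_def G"
    and "smooth M"
    and "\<And>Y. pos_def (M Y)"
    and "X \<in> stiefel G"
  shows "stiefel_normal_space M G X = {matrix_inv (M X) ** G ** X ** S | S. S \<in> Her}"
proof -
  have G: "G \<in> Her" and MX: "M X \<in> Her"
    using assms(2,4) by (auto simp: pos_def_def)
  show ?thesis
  proof (intro equalityI subsetI)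
    fix \<nu> assume \<nu>: "\<nu> \<in> stiefel_normal_space M G X"
    have "\<nu> = matrix_inv (M X) ** M X ** \<nu>"
      using assms(4) by (simp add: matrix_inv_mult pos_def_invertible)
    also have "\<dots> = matrix_inv (M X) ** (M X ** \<nu>)"
      by (simp add: matrix_mul_assoc)
    also have "\<dots> = matrix_inv (M X) ** (G ** X ** (ctranspose X ** M X ** \<nu>))"
      using normal_imp_mult_eq[OF G MX assms(5) \<nu>] by simp
    also have "\<dots> = matrix_inv (M X) ** G ** X ** (ctranspose X ** M X ** \<nu>)"
      by (simp add: matrix_mul_assoc)
    finally show "\<nu> \<in> {matrix_inv (M X) ** G ** X ** S | S. S \<in> Her}"
      using normal_imp_Her[OF G MX assms(5) \<nu>] by blast
  next
    fix \<nu> assume "\<nu> \<in> {matrix_inv (M X) ** G ** X ** S | S. S \<in> Her}"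
    then obtain S where S: "S \<in> Her" and \<nu>: "\<nu> = matrix_inv (M X) ** G ** X ** S"
      by blast
    have "riem_metric M X \<nu> \<xi> = 0" if "\<xi> \<in> stiefel_tangent_space G X" for \<xi>
      using that qre_trace_Her_skew[OF S]
      by (simp add: \<nu> riem_metric_inv_mult[of M X G S, OF assms(4) G S] stiefel_tangent_space_iff_skew[OF G])
    then show "\<nu> \<in> stiefel_normal_space M G X"
      by (simp add: stiefel_normal_space_def)
  qed
qed

end
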